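(* Let $\lambda\in\mathbb{C}$ with $\lambda\neq1$. For every integer $n\ge1$, the Daehee polynomial $D_n(x|\lambda)$ satisfies $$D_n(x|\lambda)=\frac{(n-1)!}{(1-\lambda)^n}\sum_{l=1}^{n}\sum_{j=0}^{n}\sum_{m=0}^{l-1}\frac{\binom{n}{l}\binom{n}{j}\binom{l-1}{m}(-\lambda)^{n-j}2^l}{(l-1)!}\,B_{l-1-m}^{(l)}\left\{x\,H_m^{(n-1)}(x+j|\lambda)+\frac{1}{1-\lambda}H_m^{(n)}(x+j+1|\lambda)\right\}.$$
   Context: All generating functions are formal power series in $t$, and for real $\alpha$ the power of a series with constant term $1$ is the one with constant term $1$. The Daehee polynomials $D_k(x|\lambda)$ are defined by $$\sum_{k=0}^{\infty}D_k(x|\lambda)\frac{t^k}{k!}=\left(\frac{(1-\lambda)+t(1+\lambda)}{(1-\lambda)(1-t)}\right)\left(\frac{1+t}{1-t}\right)^x.$$ For $\alpha\in\mathbb{R}$, the Frobenius-Euler polynomials of order $\alpha$ are defined by $\left(\frac{1-\lambda}{e^t-\lambda}\right)^{\alpha}e^{xt}=\sum_{n\ge0}H_n^{(\alpha)}(x|\lambda)\frac{t^n}{n!}$. The Bernoulli polynomials of order $\alpha$ are defined by $\left(\frac{t}{e^t-1}\right)^{\alpha}e^{xt}=\sum_{n\ge0}B_n^{(\alpha)}(x)\frac{t^n}{n!}$, and $B_n^{(\alpha)}=B_n^{(\alpha)}(0)$ are the Bernoulli numbers of order $\alpha$. Convention: $(-\lambda)^0=1$. *)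

theory Defs
  imports Complex_Main "HOL-Computational_Algebra.Formal_Power_Series"
begin

text \<open>
  The power of a formal power series with constant term 1, by the binomial series
  $f^a = \sum_k {a \choose k} (f - 1)^k$.  It is only meaningful if \<open>fps_nth f 0 = 1\<close>.
\<close>
definition fps_gpow :: "'a::field_char_0 fps \<Rightarrow> 'a \<Rightarrow> 'a fps" where
  "fps_gpow f a = fps_compose (fps_binomial a) (f - 1)"

lemma fps_gpow_nth_0 [simp]: "fps_nth (fps_gpow f a) 0 = 1"
  by (simp add: fps_gpow_def)

lemma fps_gpow_add:
  assumes "fps_nth f 0 = 1"
  shows "fps_gpow f (a + b) = fps_gpow f a * fps_gpow f b"
  using assms
  by (simp add: fps_gpow_def fps_binomial_add_mult fps_compose_mult_distrib)

lemma fps_gpow_of_nat: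
  assumes "fps_nth f 0 = 1"
  shows "fps_gpow f (of_nat n) = f ^ n"
  using assms
  by (simp add: fps_gpow_def fps_binomial_of_nat fps_compose_add_distrib flip: fps_compose_power)

definition daehee_poly :: "nat \<Rightarrow> complex \<Rightarrow> complex \<Rightarrow> complex" where
  "daehee_poly k x lam = fact k * fps_nth
     ((fps_const (1 - lam) + fps_X * fps_const (1 + lam)) / (fps_const (1 - lam) * (1 - fps_X))
      * fps_gpow ((1 + fps_X) / (1 - fps_X)) x) k"

definition frobenius_euler_poly :: "real \<Rightarrow> nat \<Rightarrow> complex \<Rightarrow> complex \<Rightarrow> complex" where
  "frobenius_euler_poly \<alpha> n x lam = fact n * fps_nth
     (fps_gpow (fps_const (1 - lam) / (fps_exp 1 - fps_const lam)) (of_real \<alpha>) * fps_exp x) n"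

text \<open>
  The quotient below is the one of formal power series in which the common factor
  \<open>fps_X\<close> cancels, so its constant term is 1.
\<close>
definition bernoulli_poly_ord :: "real \<Rightarrow> nat \<Rightarrow> complex \<Rightarrow> complex" where
  "bernoulli_poly_ord \<alpha> n x = fact n * fps_nth
     (fps_gpow (fps_X / (fps_exp 1 - 1)) (of_real \<alpha>) * fps_exp x) n"

definition bernoulli_num_ord :: "real \<Rightarrow> nat \<Rightarrow> complex" where
  "bernoulli_num_ord \<alpha> n = bernoulli_poly_ord \<alpha> n 0"

lemma daehee_base_nth_0: "fps_nth ((1 + fps_X) / (1 - fps_X) :: complex fps) 0 = 1"
  by (simp add: fps_divide_unit)

lemma frobenius_euler_base_nth_0:
  assumes "lam \<noteq> 1"
  shows "fps_nth (fps_const (1 - lam) / (fps_exp 1 - fps_const lam) :: complex fps) 0 = 1"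
  using assms by (simp add: fps_divide_unit)

lemma bernoulli_base_nth_0: "fps_nth (fps_X / (fps_exp 1 - 1) :: complex fps) 0 = 1"
proof -
  have sd: "subdegree (fps_exp 1 - 1 :: complex fps) = 1"
    by (rule subdegreeI) auto
  show ?thesis
    using fps_divide_nth_base[of "fps_exp 1 - 1" "fps_X :: complex fps", unfolded sd] by simp
qed

end

theory Submission
  imports Defs
begin

text \<open>
  Substitute $t = \tau(u) = (e^u - 1)/(e^u + 1)$, so that $(1+t)/(1-t) = e^u$. The generating
  function of the Daehee polynomials then becomes the elementary series
  $$F(u) = \frac{e^u - \lambda}{1 - \lambda}\, e^{xu}$$
  (\<open>daehee_gf_compose\<close>). Its coefficients with respect to $t$ are recovered by Lagrange inversion
  (\<open>lagrange_inversion\<close>): with $\varphi(u) = u/\tau(u)$,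
  $$D_n(x|\lambda) = (n-1)!\,[u^{n-1}]\; F'(u)\,\varphi(u)^n .$$

  The formula of the theorem is this coefficient, expanded in three ways at once.
  Writing $\varphi(u) = u + 2\,u/(e^u-1)$ and expanding $\varphi^n$ gives the sum over $l$
  and the generating functions $(u/(e^u-1))^l$ of the Bernoulli numbers of order $l$
  (\<open>nth_power_X_plus\<close>). Multiplying and dividing
  $F'(u) = x\,\frac{e^u-\lambda}{1-\lambda}e^{xu} + \frac{1}{1-\lambda}e^{(x+1)u}$
  by $(e^u-\lambda)^n$ and expanding the numerator binomially gives the sum over $j$ and the two
  Frobenius-Euler generating functions, of orders $n-1$ and $n$ (\<open>sum_frobenius_euler_gf\<close>).
  The sum over $m$ is the Cauchy product of the two kinds of series
  (\<open>binomial_convolution_nth\<close>).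
\<close>

section \<open>Lagrange inversion\<close>

lemma nth_power_mult_eq_0:
  fixes \<tau> f :: "'a::field_char_0 fps"
  assumes "fps_nth \<tau> 0 = 0" and "m < k"
  shows "fps_nth (\<tau> ^ k * f) m = 0"
  unfolding fps_mult_nth
  by (rule sum.neutral) (use assms startsby_zero_power_prefix[OF assms(1), of k] in auto)

text \<open>
  This is the power series form of the fact that a power $\tau^{k-n-1}\,\tau'$ has a residue only
  when the exponent is $-1$. For $k = n - s$ with $s > 0$, cancelling
  $\tau\varphi = u$ leaves the coefficient of $u^s$ in
  $\tau'\varphi^{s+1} = \varphi^s - \frac{1}{s}\, u\,(\varphi^s)'$, and the operator $u\,\frac{d}{du}$
  multiplies that coefficient of $\varphi^s$ by $s$. For $k > n$ the order of vanishing of $\tau^k$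
  decides.
\<close>
lemma lagrange_duality:
  fixes \<tau> \<phi> :: "'a::field_char_0 fps"
  assumes \<tau>0: "fps_nth \<tau> 0 = 0" and prod: "\<tau> * \<phi> = fps_X"
  shows "fps_nth (\<tau> ^ k * fps_deriv \<tau> * \<phi> ^ Suc n) n = (if k = n then 1 else 0)"
proof -
  have "fps_deriv (\<tau> * \<phi>) = 1"
    by (simp add: prod)
  then have deriv: "fps_deriv \<tau> * \<phi> = 1 - \<tau> * fps_deriv \<phi>"
    by (simp add: algebra_simps)
  consider "n < k" | "k = n" | r where "n = k + Suc r"
    using less_imp_Suc_add by (metis add_Suc_right linorder_neqE_nat)
  then show ?thesis
  proof cases
    case 1
    then show ?thesis
      using nth_power_mult_eq_0[OF \<tau>0, of n k "fps_deriv \<tau> * \<phi> ^ Suc n"]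
      by (simp add: mult.assoc)
  next
    case 2
    have "\<tau> ^ n * fps_deriv \<tau> * \<phi> ^ Suc n = (\<tau> * \<phi>) ^ n * (fps_deriv \<tau> * \<phi>)"
      by (simp add: power_mult_distrib mult_ac)
    also have "fps_nth \<dots> n = 1"
      by (simp add: prod deriv fps_X_power_mult_nth \<tau>0)
    finally show ?thesis
      using 2 by simp
  next
    case 3
    have "\<tau> ^ k * fps_deriv \<tau> * \<phi> ^ Suc n
        = (\<tau> * \<phi>) ^ k * ((fps_deriv \<tau> * \<phi>) * \<phi> * \<phi> ^ r)"
      by (simp add: 3 power_mult_distrib power_add mult_ac)
    also have "\<dots> = fps_X ^ k * ((1 - \<tau> * fps_deriv \<phi>) * \<phi> * \<phi> ^ r)"
      by (simp only: prod deriv)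
    also have "\<dots> = fps_X ^ k * (\<phi> ^ Suc r - (\<tau> * \<phi>) * fps_deriv \<phi> * \<phi> ^ r)"
      by (simp add: algebra_simps)
    finally have "fps_nth (\<tau> ^ k * fps_deriv \<tau> * \<phi> ^ Suc n) n
        = fps_nth (\<phi> ^ Suc r - fps_X * (fps_deriv \<phi> * \<phi> ^ r)) (Suc r)"
      by (simp add: 3 prod fps_X_power_mult_nth mult.assoc)
    also have "\<dots> = fps_nth (\<phi> ^ Suc r) (Suc r) - fps_nth (fps_deriv \<phi> * \<phi> ^ r) r"
      by (simp del: power_Suc)
    also have "of_nat (Suc r) * \<dots> = 0"
    proof -
      have "of_nat (Suc r) * fps_nth (\<phi> ^ Suc r) (Suc r) = fps_nth (fps_deriv (\<phi> ^ Suc r)) r"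
        by (simp only: fps_deriv_nth Suc_eq_plus1)
      also have "\<dots> = of_nat (Suc r) * fps_nth (fps_deriv \<phi> * \<phi> ^ r) r"
        unfolding fps_deriv_power by (simp only: mult.assoc fps_mult_left_const_nth diff_Suc_1)
      finally show ?thesis
        by (simp only: right_diff_distrib) simp
    qed
    finally show ?thesis
      using 3 by (simp del: of_nat_Suc power_Suc)
  qed
qed

text \<open>
  By the chain rule the derivative of the composite is a combination of the series
  $\tau^k\,\tau'$ with the coefficients of $g'$, and the preceding duality singles out the one
  with $k = n$.
\<close>
theorem lagrange_inversion:
  fixes \<tau> \<phi> g :: "'a::field_char_0 fps"
  assumes \<tau>0: "fps_nth \<tau> 0 = 0" and prod: "\<tau> * \<phi> = fps_X"
  shows "of_nat (Suc n) * fps_nth g (Suc n)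
    = fps_nth (fps_deriv (g oo \<tau>) * \<phi> ^ Suc n) n"
proof -
  define h where "h = fps_deriv g"
  define w where "w = fps_deriv \<tau> * \<phi> ^ Suc n"
  \<comment> \<open>Since \<open>\<tau>\<close> vanishes at 0, one summation range serves all coefficients up to \<open>n\<close>;
      this makes the interchange of sums below possible.\<close>
  have compose: "fps_nth (h oo \<tau>) i = (\<Sum>k\<le>n. fps_nth h k * fps_nth (\<tau> ^ k) i)" if "i \<le> n" for i
    unfolding fps_compose_nth
    by (rule sum.mono_neutral_left) (use that startsby_zero_power_prefix[OF \<tau>0] in auto)
  have "fps_nth (fps_deriv (g oo \<tau>) * \<phi> ^ Suc n) n = fps_nth ((h oo \<tau>) * w) n"
    by (simp only: fps_compose_deriv[OF \<tau>0] h_def w_def mult.assoc)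
  also have "\<dots> = (\<Sum>i = 0..n. \<Sum>k\<le>n. fps_nth h k * fps_nth (\<tau> ^ k) i * fps_nth w (n - i))"
    unfolding fps_mult_nth by (rule sum.cong) (simp_all add: compose sum_distrib_right)
  also have "\<dots> = (\<Sum>k\<le>n. fps_nth h k * fps_nth (\<tau> ^ k * w) n)"
    by (subst sum.swap) (simp add: fps_mult_nth sum_distrib_left mult.assoc)
  also have "\<dots> = (\<Sum>k\<le>n. fps_nth h k * (if k = n then 1 else 0))"
    unfolding w_def mult.assoc[symmetric] by (simp only: lagrange_duality[OF assms])
  also have "\<dots> = fps_nth h n"
    by (simp add: if_distrib cong: if_cong)
  finally show ?thesis
    by (simp add: h_def)
qed

section \<open>The Daehee generating function in exponential coordinates\<close>

text \<open>
  $(1 + z)^a$ at $z = e^u - 1$: the differential equation $(1+z)\,y' = a\,y$ of the binomial series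
  turns into the equation $y' = a\,y$ that characterises $e^{au}$.
\<close>
lemma fps_binomial_compose_exp:
  fixes a :: "'a::field_char_0"
  shows "fps_binomial a oo (fps_exp 1 - 1) = fps_exp a"
proof -
  define e where "e = (fps_exp 1 - 1 :: 'a fps)"
  have e0: "fps_nth e 0 = 0"
    by (simp add: e_def)
  have unit: "fps_nth (1 + fps_X :: 'a fps) 0 \<noteq> 0"
    by simp
  have "fps_deriv (fps_binomial a) * (1 + fps_X) = fps_const a * fps_binomial a"
    unfolding fps_binomial_deriv fps_divide_unit[OF unit]
    by (simp only: mult.assoc inverse_mult_eq_1[OF unit] mult_1_right)
  then have "(fps_deriv (fps_binomial a) * (1 + fps_X)) oo e = (fps_const a * fps_binomial a) oo e"
    by simp
  then have ode: "(fps_deriv (fps_binomial a) oo e) * (1 + e) = fps_const a * (fps_binomial a oo e)"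
    by (simp add: fps_compose_mult_distrib[OF e0] fps_compose_add_distrib e0)
  have "fps_deriv (fps_binomial a oo e) = (fps_deriv (fps_binomial a) oo e) * (1 + e)"
    by (simp add: fps_compose_deriv[OF e0]) (simp add: e_def)
  also note ode
  finally have "fps_binomial a oo e = fps_const (fps_nth (fps_binomial a oo e) 0) * fps_exp a"
    by (simp only: fps_exp_unique_ODE)
  then show ?thesis
    by (simp add: e_def)
qed

lemma fps_gpow_compose_exp:
  assumes \<tau>0: "fps_nth \<tau> 0 = 0" and f0: "fps_nth f 0 = 1" and f: "f oo \<tau> = fps_exp 1"
  shows "fps_gpow f a oo \<tau> = fps_exp a"
  using fps_compose_assoc[of \<tau> "f - 1" "fps_binomial a"]
  by (simp add: fps_gpow_def \<tau>0 f0 f fps_compose_sub_distrib fps_binomial_compose_exp)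

text \<open>
  The inverse of $u = \ln\frac{1+t}{1-t}$, that is, $\tanh(u/2)$.
\<close>
definition tanh_half :: "complex fps" where
  "tanh_half = (fps_exp 1 - 1) / (fps_exp 1 + 1)"

lemma tanh_half_mult: "tanh_half * (fps_exp 1 + 1) = fps_exp 1 - 1"
proof -
  have unit: "fps_nth (fps_exp 1 + 1 :: complex fps) 0 \<noteq> 0"
    by simp
  show ?thesis
    unfolding tanh_half_def fps_divide_unit[OF unit]
    by (simp only: mult.assoc inverse_mult_eq_1[OF unit] mult_1_right)
qed

lemma tanh_half_nth_0 [simp]: "fps_nth tanh_half 0 = 0"
  by (simp add: tanh_half_def fps_divide_unit)

lemma one_plus_tanh_half: "1 + tanh_half = fps_exp 1 * (1 - tanh_half)"
  using tanh_half_mult by (simp add: algebra_simps)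

text \<open>
  The denominator is not a unit, so the cancellation rests on its having order exactly 1.
\<close>
lemma bernoulli_base_mult: "fps_X / (fps_exp 1 - 1) * (fps_exp 1 - 1) = (fps_X :: complex fps)"
proof -
  have "fps_exp 1 - 1 \<noteq> (0 :: complex fps)"
    by simp
  moreover have "subdegree (fps_exp 1 - 1 :: complex fps) = 1"
    by (rule subdegreeI) auto
  ultimately have "fps_exp 1 - 1 dvd (fps_X :: complex fps)"
    by (simp add: fps_dvd_iff)
  then show ?thesis
    by simp
qed

text \<open>
  This identifies the series $\varphi(u) = u/\tau(u) = u\,\frac{e^u+1}{e^u-1}$ needed for Lagrange inversion,
  split so that only the base of the Bernoulli generating function carries a denominator:
  $\frac{e^u+1}{e^u-1} = 1 + \frac{2}{e^u-1}$.
\<close>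
lemma tanh_half_mult_cofactor:
  "tanh_half * (fps_X + fps_const 2 * (fps_X / (fps_exp 1 - 1))) = fps_X"
proof -
  define P :: "complex fps" where "P = fps_X / (fps_exp 1 - 1)"
  have P: "P * (fps_exp 1 - 1) = fps_X"
    unfolding P_def by (rule bernoulli_base_mult)
  have "tanh_half * (fps_X + fps_const 2 * P) * (fps_exp 1 + 1)
      = (tanh_half * (fps_exp 1 + 1)) * (fps_X + fps_const 2 * P)"
    by (simp only: mult_ac)
  also have "\<dots> = fps_X * (fps_exp 1 - 1) + fps_const 2 * (P * (fps_exp 1 - 1))"
    unfolding tanh_half_mult by (simp add: algebra_simps)
  also have "\<dots> = fps_X * (fps_exp 1 + 1)"
    unfolding P by (simp add: algebra_simps flip: numeral_fps_const)
  finally have "tanh_half * (fps_X + fps_const 2 * P) * (fps_exp 1 + 1) = fps_X * (fps_exp 1 + 1)" .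
  moreover have "fps_exp 1 + 1 \<noteq> (0 :: complex fps)"
    by (metis fps_add_nth fps_exp_nth fps_one_nth fps_zero_nth fact_0 div_by_1 of_nat_1 one_add_one
        power_0 zero_neq_numeral)
  ultimately show ?thesis
    by (simp add: P_def)
qed

text \<open>
  Both factors simplify because $1 + \tau = e^u(1 - \tau)$: the base of the power becomes $e^u$, and
  the numerator of the prefactor is
  $(1+\tau) - \lambda(1-\tau) = (e^u - \lambda)(1-\tau)$, whose last factor cancels.
\<close>
lemma daehee_gf_compose:
  fixes lam x :: complex
  assumes "lam \<noteq> 1"
  shows "((fps_const (1 - lam) + fps_X * fps_const (1 + lam)) / (fps_const (1 - lam) * (1 - fps_X))
      * fps_gpow ((1 + fps_X) / (1 - fps_X)) x) oo tanh_half
    = fps_const (1 / (1 - lam)) * (fps_exp 1 - fps_const lam) * fps_exp x"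
proof -
  note distribs = fps_compose_mult_distrib fps_compose_add_distrib fps_compose_sub_distrib
  have nz: "1 - tanh_half \<noteq> 0"
    by (metis fps_sub_nth fps_one_nth fps_zero_nth tanh_half_nth_0 diff_zero zero_neq_one)
  have "((1 + fps_X) / (1 - fps_X)) oo tanh_half = (1 + tanh_half) / (1 - tanh_half)"
    by (subst fps_divide_compose) (simp_all add: distribs)
  also have "\<dots> = fps_exp 1"
    unfolding one_plus_tanh_half using nz by simp
  finally have pow: "fps_gpow ((1 + fps_X) / (1 - fps_X)) x oo tanh_half = fps_exp x"
    by (intro fps_gpow_compose_exp tanh_half_nth_0 daehee_base_nth_0)
  have "((fps_const (1 - lam) + fps_X * fps_const (1 + lam)) / (fps_const (1 - lam) * (1 - fps_X)))
        oo tanh_half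
      = (fps_const (1 - lam) + tanh_half * fps_const (1 + lam))
        / (fps_const (1 - lam) * (1 - tanh_half))"
    using assms by (subst fps_divide_compose) (simp_all add: distribs del: fps_const_sub fps_const_add)
  also have "fps_const (1 - lam) + tanh_half * fps_const (1 + lam)
      = (1 + tanh_half) - fps_const lam * (1 - tanh_half)"
    by (simp add: algebra_simps flip: fps_const_add fps_const_sub)
  also have "\<dots> = (fps_exp 1 - fps_const lam) * (1 - tanh_half)"
    unfolding one_plus_tanh_half by (simp only: left_diff_distrib)
  also have "\<dots> = (fps_const (1 / (1 - lam)) * (fps_exp 1 - fps_const lam))
      * (fps_const (1 - lam) * (1 - tanh_half))"
    using assms by (simp add: mult_ac flip: mult.assoc)
  also have "\<dots> / (fps_const (1 - lam) * (1 - tanh_half))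
      = fps_const (1 / (1 - lam)) * (fps_exp 1 - fps_const lam)"
    using assms nz by (intro nonzero_mult_div_cancel_right) simp
  finally show ?thesis
    by (simp only: fps_compose_mult_distrib[OF tanh_half_nth_0] pow)
qed

section \<open>Expansion into Bernoulli numbers and Frobenius-Euler polynomials\<close>

text \<open>
  In the binomial expansion the factor $u^{n-l}$ lowers the index from $n-1$ to $l-1$. The term
  $l = 0$ drops out, since $u^n$ has no coefficient at $n-1$.
\<close>
lemma nth_power_X_plus:
  fixes f g :: "'a::field_char_0 fps"
  assumes "n \<ge> 1"
  shows "fps_nth (g * (fps_X + fps_const c * f) ^ n) (n - 1)
    = (\<Sum>l = 1..n. of_nat (n choose l) * c ^ l * fps_nth (f ^ l * g) (l - 1))"
proof -
  have "g * (fps_X + fps_const c * f) ^ n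
      = (\<Sum>l = 0..n. fps_const (of_nat (n choose l) * c ^ l) * (fps_X ^ (n - l) * (f ^ l * g)))"
    unfolding add.commute[of fps_X] binomial_ring atLeast0AtMost
    by (simp add: sum_distrib_left power_mult_distrib fps_const_power fps_of_nat mult_ac
        flip: fps_const_mult)
  then have "fps_nth (g * (fps_X + fps_const c * f) ^ n) (n - 1)
      = (\<Sum>l = 0..n. of_nat (n choose l) * c ^ l * fps_nth (fps_X ^ (n - l) * (f ^ l * g)) (n - 1))"
    by (simp only: fps_sum_nth fps_mult_left_const_nth)
  also have "\<dots> = (\<Sum>l = 1..n. of_nat (n choose l) * c ^ l
      * fps_nth (fps_X ^ (n - l) * (f ^ l * g)) (n - 1))"
    using assms by (simp add: sum.atLeast_Suc_atMost fps_X_power_mult_nth)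
  also have "\<dots> = (\<Sum>l = 1..n. of_nat (n choose l) * c ^ l * fps_nth (f ^ l * g) (l - 1))"
    by (rule sum.cong) (auto simp: fps_X_power_mult_nth intro!: arg_cong2[where f = fps_nth])
  finally show ?thesis .
qed

lemma bernoulli_num_ord_of_nat:
  "bernoulli_num_ord (real l) k = fact k * fps_nth ((fps_X / (fps_exp 1 - 1)) ^ l) k"
  unfolding bernoulli_num_ord_def bernoulli_poly_ord_def
  by (simp add: fps_gpow_of_nat[OF bernoulli_base_nth_0])

lemma frobenius_euler_poly_of_nat:
  assumes "lam \<noteq> 1"
  shows "frobenius_euler_poly (real n) k y lam
    = fact k * fps_nth ((fps_const (1 - lam) / (fps_exp 1 - fps_const lam)) ^ n * fps_exp y) k"
  unfolding frobenius_euler_poly_def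
  by (simp add: fps_gpow_of_nat[OF frobenius_euler_base_nth_0[OF assms]])

text \<open>
  The Cauchy product for exponential generating functions, in the normalisation in which the
  Bernoulli numbers and Frobenius-Euler polynomials occur.
\<close>
lemma binomial_convolution_nth:
  fixes f g :: "'a::field_char_0 fps"
  shows "(\<Sum>m = 0..k. of_nat (k choose m) / fact k * (fact (k - m) * fps_nth f (k - m))
      * (fact m * fps_nth g m)) = fps_nth (f * g) k"
  unfolding mult.commute[of f g] fps_mult_nth
  by (rule sum.cong) (auto simp: binomial_fact field_simps)

lemma sum_binomial_exp_shift:
  fixes a y :: "'a::field_char_0"
  shows "(\<Sum>j = 0..n. fps_const (of_nat (n choose j) * (- a) ^ (n - j)) * fps_exp (y + of_nat j))
    = (fps_exp 1 - fps_const a) ^ n * fps_exp y"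
proof -
  have "(fps_exp 1 - fps_const a) ^ n = (fps_exp 1 + fps_const (- a)) ^ n"
    by (simp only: diff_conv_add_uminus fps_const_neg)
  also have "\<dots> = (\<Sum>j = 0..n. fps_const (of_nat (n choose j) * (- a) ^ (n - j)) * fps_exp (of_nat j))"
    unfolding binomial_ring atLeast0AtMost
    by (simp add: fps_exp_power_mult fps_const_power fps_of_nat mult_ac
        flip: fps_const_mult del: fps_const_neg)
  finally show ?thesis
    by (simp add: sum_distrib_left fps_exp_add_mult mult_ac)
qed

text \<open>
  The binomial sum over the shifts $j$ produces the factor $(e^u-\lambda)^n$, which clears the
  denominators of $Q^{n-1}$ and $Q^n$. One factor $e^u - \lambda$ survives in the first summand and
  none in the second; these are the two terms of the product rule.
\<close>
lemma sum_frobenius_euler_gf: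
  fixes lam x :: complex
  assumes lam: "lam \<noteq> 1" and n: "n \<ge> 1"
  defines "Q \<equiv> fps_const (1 - lam) / (fps_exp 1 - fps_const lam)"
  shows "(\<Sum>j = 0..n. fps_const (of_nat (n choose j) * (- lam) ^ (n - j))
      * (fps_const x * (Q ^ (n - 1) * fps_exp (x + of_nat j))
         + fps_const (1 / (1 - lam)) * (Q ^ n * fps_exp (x + of_nat j + 1))))
    = fps_const ((1 - lam) ^ n)
      * fps_deriv (fps_const (1 / (1 - lam)) * (fps_exp 1 - fps_const lam) * fps_exp x)"
    (is "?lhs = _")
proof -
  define V :: "complex fps" where "V = fps_exp 1 - fps_const lam"
  define b where "b = 1 / (1 - lam)"
  define s where "s y = (\<Sum>j = 0..n. fps_const (of_nat (n choose j) * (- lam) ^ (n - j))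
    * fps_exp (y + of_nat j))" for y
  have unit: "fps_nth V 0 \<noteq> 0"
    using lam by (simp add: V_def)
  have QV: "Q * V = fps_const (1 - lam)"
    unfolding Q_def V_def[symmetric] fps_divide_unit[OF unit]
    by (simp only: mult.assoc inverse_mult_eq_1[OF unit] mult_1_right)
  have s: "s y = V ^ n * fps_exp y" for y
    unfolding s_def V_def by (rule sum_binomial_exp_shift)
  obtain k where k: "n = Suc k"
    using n by (cases n) auto
  have "?lhs = fps_const x * Q ^ (n - 1) * s x + fps_const b * Q ^ n * s (x + 1)"
    unfolding b_def[symmetric]
    by (simp add: s_def sum_distrib_left sum.distrib algebra_simps del: fps_const_mult)
  also have "\<dots> = fps_const x * ((Q * V) ^ k * V) * fps_exp x
      + fps_const b * (Q * V) ^ n * fps_exp (x + 1)"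
    by (simp add: s k power_mult_distrib mult_ac)
  also have "\<dots> = fps_const ((1 - lam) ^ n)
      * (fps_const b * (fps_const x * V * fps_exp x + fps_exp 1 * fps_exp x))"
  proof -
    have "fps_const ((1 - lam) ^ k) = fps_const ((1 - lam) ^ n) * fps_const b"
      using lam by (simp add: k b_def)
    then show ?thesis
      unfolding QV fps_const_power fps_exp_add_mult by (simp only: algebra_simps)
  qed
  also have "fps_const b * (fps_const x * V * fps_exp x + fps_exp 1 * fps_exp x)
      = fps_deriv (fps_const b * V * fps_exp x)"
    by (simp add: V_def algebra_simps)
  finally show ?thesis
    by (simp only: V_def b_def)
qed

theorem theorem2:
  fixes lam x :: complex and n :: nat
  assumes "lam \<noteq> 1" and "n \<ge> 1"
  shows "daehee_poly n x lam =
    fact (n - 1) / (1 - lam) ^ n *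
    (\<Sum>l = 1..n. \<Sum>j = 0..n. \<Sum>m = 0..l - 1.
       of_nat (n choose l) * of_nat (n choose j) * of_nat ((l - 1) choose m)
         * (- lam) ^ (n - j) * 2 ^ l / fact (l - 1)
       * bernoulli_num_ord (real l) (l - 1 - m)
       * (x * frobenius_euler_poly (real (n - 1)) m (x + of_nat j) lam
          + 1 / (1 - lam) * frobenius_euler_poly (real n) m (x + of_nat j + 1) lam))"
proof -
  define G where "G = (fps_const (1 - lam) + fps_X * fps_const (1 + lam))
      / (fps_const (1 - lam) * (1 - fps_X)) * fps_gpow ((1 + fps_X) / (1 - fps_X)) x"
  define F where "F = fps_const (1 / (1 - lam)) * (fps_exp 1 - fps_const lam) * fps_exp x"
  define P :: "complex fps" where "P = fps_X / (fps_exp 1 - 1)"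
  define Q where "Q = fps_const (1 - lam) / (fps_exp 1 - fps_const lam)"
  define K where "K j = fps_const x * (Q ^ (n - 1) * fps_exp (x + of_nat j))
      + fps_const (1 / (1 - lam)) * (Q ^ n * fps_exp (x + of_nat j + 1))" for j
  define c where "c j = of_nat (n choose j) * (- lam) ^ (n - j)" for j
  have K: "x * frobenius_euler_poly (real (n - 1)) m (x + of_nat j) lam
      + 1 / (1 - lam) * frobenius_euler_poly (real n) m (x + of_nat j + 1) lam
      = fact m * fps_nth (K j) m" for j m
    unfolding frobenius_euler_poly_of_nat[OF assms(1)] Q_def[symmetric] K_def
      fps_add_nth fps_mult_left_const_nth
    by (simp add: algebra_simps)
  have inner: "(\<Sum>m = 0..l - 1.
       of_nat (n choose l) * of_nat (n choose j) * of_nat ((l - 1) choose m)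
         * (- lam) ^ (n - j) * 2 ^ l / fact (l - 1)
       * bernoulli_num_ord (real l) (l - 1 - m) * (fact m * fps_nth (K j) m))
      = of_nat (n choose l) * 2 ^ l * (c j * fps_nth (P ^ l * K j) (l - 1))" for l j
    unfolding binomial_convolution_nth[of "l - 1" "P ^ l" "K j", symmetric]
      bernoulli_num_ord_of_nat P_def[symmetric] sum_distrib_left c_def
    by (rule sum.cong) simp_all
  have middle: "(\<Sum>j = 0..n. c j * fps_nth (P ^ l * K j) (l - 1))
      = (1 - lam) ^ n * fps_nth (P ^ l * fps_deriv F) (l - 1)" for l
  proof -
    have "(\<Sum>j = 0..n. c j * fps_nth (P ^ l * K j) (l - 1))
        = fps_nth (P ^ l * (\<Sum>j = 0..n. fps_const (c j) * K j)) (l - 1)"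
      by (simp add: sum_distrib_left fps_sum_nth mult.left_commute[of "P ^ l"])
    also have "(\<Sum>j = 0..n. fps_const (c j) * K j) = fps_const ((1 - lam) ^ n) * fps_deriv F"
      unfolding c_def K_def Q_def F_def by (rule sum_frobenius_euler_gf[OF assms])
    finally show ?thesis
      by (simp only: mult.left_commute[of "P ^ l"] fps_mult_left_const_nth)
  qed
  have "daehee_poly n x lam = fact (n - 1) * (of_nat n * fps_nth G n)"
    using assms(2) by (simp add: daehee_poly_def G_def fact_reduce)
  also have "of_nat n * fps_nth G n
      = fps_nth (fps_deriv F * (fps_X + fps_const 2 * P) ^ n) (n - 1)"
    using lagrange_inversion[OF tanh_half_nth_0 tanh_half_mult_cofactor, of "n - 1" G]
      assms(2) daehee_gf_compose[OF assms(1), of x]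
    by (simp only: G_def F_def P_def) simp
  also have "\<dots> = (\<Sum>l = 1..n. of_nat (n choose l) * 2 ^ l * fps_nth (P ^ l * fps_deriv F) (l - 1))"
    by (rule nth_power_X_plus[OF assms(2)])
  also have "fact (n - 1) * \<dots> = fact (n - 1) / (1 - lam) ^ n
      * (\<Sum>l = 1..n. of_nat (n choose l) * 2 ^ l
          * (\<Sum>j = 0..n. c j * fps_nth (P ^ l * K j) (l - 1)))"
    unfolding middle using assms(1)
    by (simp add: sum_distrib_left mult_ac)
  finally show ?thesis
    unfolding K inner by (simp only: sum_distrib_left)
qed

end
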